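(* In four dimensions, let $\boldsymbol v^0(\cdot,\boldsymbol\xi)$ be the quadruple-periodic field of the context with $$\boldsymbol\xi=\left(\theta,\ \theta+a+\ell_1\pi,\ \theta+\tfrac{\pi}{2}+\ell_2\pi,\ \theta+a+\ell_3\pi\right),\qquad\theta,a\in\mathbb R,\ \ell_1,\ell_2,\ell_3\in\mathbb Z.$$ Then the pressure-integrability condition $\partial_jg_i^0=\partial_ig_j^0$ (identically in $\boldsymbol x$, for all $1\le i<j\le4$) holds if and only if $\sin^2 a\,\cos a=0$, that is, if and only if $a\equiv0$ or $a\equiv\tfrac{\pi}{2}$ modulo $\pi$. If $a\equiv0\pmod\pi$ then $\boldsymbol v^0\equiv\boldsymbol0$; if $a\equiv\tfrac{\pi}{2}\pmod\pi$ then $\boldsymbol v^0\not\equiv\boldsymbol0$. Thus, among the phase vectors of the displayed form, those with non-trivial field satisfying the pressure-integrability condition are exactly $$\boldsymbol\xi=\left(\theta,\ \theta+\tfrac{\pi}{2}+\ell_1\pi,\ \theta+\tfrac{\pi}{2}+\ell_2\pi,\ \theta+\tfrac{\pi}{2}+\ell_3\pi\right),\qquad\theta\in\mathbb R,\ \ell_1,\ell_2,\ell_3\in\mathbb Z.$$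
   Context: With $\alpha>0$, $v_r>0$, $$\frac{v_1^0}{v_r}=\sin(\alpha x_1+\xi_1)\cos(\alpha x_2+\xi_2)\sin(\alpha x_3+\xi_3)\cos(\alpha x_4+\xi_4)-\sin(\alpha x_1+\xi_2)\sin(\alpha x_2+\xi_3)\cos(\alpha x_3+\xi_4)\cos(\alpha x_4+\xi_1),$$ and $v_i^0$ is obtained from $v_1^0$ by the cyclic coordinate permutation $x_j\mapsto x_{i+j-1}$ (indices modulo 4, in $\{1,2,3,4\}$) with the same $\boldsymbol\xi$. The convective field is $g_i^0=\sum_{j=1}^4v_j^0\,\partial v_i^0/\partial x_j$. *)

theory Defs
  imports "HOL-Analysis.Analysis" "HOL-Library.Real_Mod"
begin

text \<open>
  Points, velocities and phases all live in \<^typ>\<open>real ^ 4\<close>, with components indexed by the type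
  \<^typ>\<open>4\<close>. Arithmetic on that type is modulo 4, and \<open>4 = 0\<close> there is the fourth index, so that
  \<open>i + j - 1\<close> is the cyclic index with representatives in \<open>{1, 2, 3, 4}\<close>.
\<close>

definition first_component :: "real \<Rightarrow> real \<Rightarrow> real ^ 4 \<Rightarrow> real ^ 4 \<Rightarrow> real" where
  "first_component \<alpha> v\<^sub>r \<xi> x = v\<^sub>r *
     (sin (\<alpha> * x $ 1 + \<xi> $ 1) * cos (\<alpha> * x $ 2 + \<xi> $ 2) *
      sin (\<alpha> * x $ 3 + \<xi> $ 3) * cos (\<alpha> * x $ 4 + \<xi> $ 4)
    - sin (\<alpha> * x $ 1 + \<xi> $ 2) * sin (\<alpha> * x $ 2 + \<xi> $ 3) *
      cos (\<alpha> * x $ 3 + \<xi> $ 4) * cos (\<alpha> * x $ 4 + \<xi> $ 1))"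

definition velocity :: "real \<Rightarrow> real \<Rightarrow> real ^ 4 \<Rightarrow> real ^ 4 \<Rightarrow> real ^ 4" where
  "velocity \<alpha> v\<^sub>r \<xi> x = (\<chi> i. first_component \<alpha> v\<^sub>r \<xi> (\<chi> j. x $ (i + j - 1)))"

definition partial_deriv :: "'n \<Rightarrow> (real ^ 'n \<Rightarrow> real) \<Rightarrow> real ^ 'n \<Rightarrow> real" where
  "partial_deriv j f x = deriv (\<lambda>t. f (x + t *\<^sub>R axis j 1)) 0"

definition convective_field :: "(real ^ 'n \<Rightarrow> real ^ 'n) \<Rightarrow> real ^ 'n \<Rightarrow> real ^ 'n" where
  "convective_field v x = (\<chi> i. \<Sum>j\<in>UNIV. v x $ j * partial_deriv j (\<lambda>y. v y $ i) x)"

text \<open>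
  The equation is symmetric in \<open>i\<close> and \<open>j\<close>, so \<open>i \<noteq> j\<close> gives the same conditions as
  \<open>1 \<le> i < j \<le> 4\<close>; the order of type \<^typ>\<open>4\<close> is avoided because \<open>4 = 0\<close> is its least element.
\<close>

definition pressure_integrable :: "(real ^ 'n \<Rightarrow> real ^ 'n) \<Rightarrow> bool" where
  "pressure_integrable v \<longleftrightarrow>
     (\<forall>x i j. i \<noteq> j \<longrightarrow>
        partial_deriv j (\<lambda>y. convective_field v y $ i) x =
        partial_deriv i (\<lambda>y. convective_field v y $ j) x)"

definition phase :: "real \<Rightarrow> real \<Rightarrow> int \<Rightarrow> int \<Rightarrow> int \<Rightarrow> real ^ 4" where
  "phase \<theta> a l\<^sub>1 l\<^sub>2 l\<^sub>3 =
     vector [\<theta>, \<theta> + a + of_int l\<^sub>1 * pi, \<theta> + pi / 2 + of_int l\<^sub>2 * pi, \<theta> + a + of_int l\<^sub>3 * pi]"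

lemma vector_4 [simp]:
  "(vector [w, x, y, z] :: 'a::zero ^ 4) $ 1 = w"
  "(vector [w, x, y, z] :: 'a::zero ^ 4) $ 2 = x"
  "(vector [w, x, y, z] :: 'a::zero ^ 4) $ 3 = y"
  "(vector [w, x, y, z] :: 'a::zero ^ 4) $ 4 = z"
  unfolding vector_def by simp_all

lemma index_4_cyclic:
  "(5 :: 4) = 1" "(6 :: 4) = 2" "(7 :: 4) = 3"
  by simp_all

lemma velocity_components:
  "velocity \<alpha> v\<^sub>r \<xi> x $ 1 = first_component \<alpha> v\<^sub>r \<xi> (vector [x $ 1, x $ 2, x $ 3, x $ 4])"
  "velocity \<alpha> v\<^sub>r \<xi> x $ 2 = first_component \<alpha> v\<^sub>r \<xi> (vector [x $ 2, x $ 3, x $ 4, x $ 1])"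
  "velocity \<alpha> v\<^sub>r \<xi> x $ 3 = first_component \<alpha> v\<^sub>r \<xi> (vector [x $ 3, x $ 4, x $ 1, x $ 2])"
  "velocity \<alpha> v\<^sub>r \<xi> x $ 4 = first_component \<alpha> v\<^sub>r \<xi> (vector [x $ 4, x $ 1, x $ 2, x $ 3])"
  unfolding velocity_def first_component_def by (simp_all add: index_4_cyclic)

end

theory Submission
  imports Defs
begin

text \<open>
  Put \<open>y\<^sub>i = \<alpha> x\<^sub>i + \<theta>\<close>. The shifts by multiples of \<open>\<pi>\<close> contribute only a common sign, so up to
  that sign \<open>v\<^sub>i = v\<^sub>r F(y\<^sub>i, y\<^sub>i\<^sub>+\<^sub>1, y\<^sub>i\<^sub>+\<^sub>2, y\<^sub>i\<^sub>+\<^sub>3)\<close> for one function \<open>F\<close> (here \<open>profile a\<close>), which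
  depends on \<open>a\<close> only. The sign squares away, because the convective field is quadratic in the velocity.
  The function \<open>F\<close> is linear in the sine and cosine of each of its arguments, so that a partial
  derivative is a shift of one argument by \<open>\<pi>/2\<close>; this makes the convective field an explicit
  trigonometric polynomial (\<open>convective_field_profile_field\<close>).

  Expanding the sums of angles shows that \<open>F\<close> is divisible by \<open>sin a\<close>, which settles \<open>sin a = 0\<close>.
  If \<open>cos a = 0\<close>, the quadratic expression collapses to
  \<open>g\<^sub>i = \<alpha> v\<^sub>r\<^sup>2 sin y\<^sub>i cos y\<^sub>i cos (2 y\<^sub>i\<^sub>+\<^sub>2)\<close> (\<open>profile_convection_gradient\<close>), which is the gradient of
  \<open>- v\<^sub>r\<^sup>2/4 (cos 2y\<^sub>1 cos 2y\<^sub>3 + cos 2y\<^sub>2 cos 2y\<^sub>4)\<close>. In all other cases one curl component at one point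
  obstructs integrability: at \<open>y = (0, 0, \<pi>/2, 0)\<close> one finds
  \<open>\<partial>\<^sub>2g\<^sub>1 - \<partial>\<^sub>1g\<^sub>2 = - 2 \<alpha>\<^sup>2 v\<^sub>r\<^sup>2 cos\<^sup>2 a sin\<^sup>2 a\<close> (\<open>not_pressure_integrable\<close>).
\<close>

section \<open>The field as cyclic copies of one profile\<close>

definition profile :: "real \<Rightarrow> real \<Rightarrow> real \<Rightarrow> real \<Rightarrow> real \<Rightarrow> real" where
  "profile a p q r s =
     sin p * cos (q + a) * cos r * cos (s + a) - sin (p + a) * cos q * cos (r + a) * cos s"

definition angle :: "real \<Rightarrow> real \<Rightarrow> real ^ 4 \<Rightarrow> 4 \<Rightarrow> real" where
  "angle \<alpha> \<theta> x i = \<alpha> * x $ i + \<theta>"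

text \<open>
  The amplitude \<open>c\<close> is kept apart from \<open>v\<^sub>r\<close> because it absorbs the sign that the multiples of \<open>\<pi>\<close>
  in the phases produce.
\<close>
definition profile_field :: "real \<Rightarrow> real \<Rightarrow> real \<Rightarrow> real \<Rightarrow> real ^ 4 \<Rightarrow> real ^ 4" where
  "profile_field \<alpha> \<theta> a c x =
     (\<chi> i. c * profile a (angle \<alpha> \<theta> x i) (angle \<alpha> \<theta> x (i + 1)) (angle \<alpha> \<theta> x (i + 2)) (angle \<alpha> \<theta> x (i + 3)))"

lemma sin_add_int_pi: "sin (y + of_int l * pi) = cos (pi * of_int l) * sin y" for y :: real
  by (simp add: sin_add mult.commute)

lemma cos_add_int_pi: "cos (y + of_int l * pi) = cos (pi * of_int l) * cos y" for y :: real
  by (simp add: cos_add mult.commute)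

lemma sin_cos_add_half_pi:
  "sin (y + pi / 2) = cos y" "cos (y + pi / 2) = - sin y"
  "sin (y + pi / 2 + a) = cos (y + a)" "cos (y + pi / 2 + a) = - sin (y + a)" for y a :: real
  using sin_add[of y "pi/2"] cos_add[of y "pi/2"] sin_add[of "y + a" "pi/2"] cos_add[of "y + a" "pi/2"]
  by (simp_all add: add_ac)

text \<open>
  Both products in the first component contain each of the phases \<open>\<xi>\<^sub>2, \<xi>\<^sub>3, \<xi>\<^sub>4\<close> exactly once, so the three
  signs coming from \<open>l\<^sub>1, l\<^sub>2, l\<^sub>3\<close> factor out of their difference, and the remaining \<open>\<pi>/2\<close> in \<open>\<xi>\<^sub>3\<close>
  turns a sine into a cosine.
\<close>
lemma velocity_phase_eq_profile_field:
  obtains c where "c\<^sup>2 = v\<^sub>r\<^sup>2"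
    and "velocity \<alpha> v\<^sub>r (phase \<theta> a l\<^sub>1 l\<^sub>2 l\<^sub>3) = profile_field \<alpha> \<theta> a c"
proof
  let ?\<sigma> = "\<lambda>l::int. cos (pi * of_int l)"
  let ?c = "v\<^sub>r * (?\<sigma> l\<^sub>1 * ?\<sigma> l\<^sub>2 * ?\<sigma> l\<^sub>3)"
  show "?c\<^sup>2 = v\<^sub>r\<^sup>2"
    by (simp add: power_mult_distrib)
  have reassoc: "sin (u + (\<theta> + b + of_int l * pi)) = ?\<sigma> l * sin (u + \<theta> + b)"
    "cos (u + (\<theta> + b + of_int l * pi)) = ?\<sigma> l * cos (u + \<theta> + b)" for u b l
    using sin_add_int_pi[of "u + \<theta> + b" l] cos_add_int_pi[of "u + \<theta> + b" l]
    by (simp_all only: add.assoc)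
  have indices: "i + 1 - 1 = i" "i + 2 - 1 = i + 1" "i + 3 - 1 = i + 2" "i + 4 - 1 = i + 3"
    for i :: 4
    using exhaust_4[of i] by (auto simp: index_4_cyclic)
  show "velocity \<alpha> v\<^sub>r (phase \<theta> a l\<^sub>1 l\<^sub>2 l\<^sub>3) = profile_field \<alpha> \<theta> a ?c"
    unfolding velocity_def first_component_def phase_def profile_field_def profile_def angle_def
    by (simp only: fun_eq_iff vec_eq_iff vec_lambda_beta vector_4 indices reassoc sin_cos_add_half_pi)
       (simp add: algebra_simps)
qed

lemma exists_point_with_angles:
  assumes "\<alpha> \<noteq> 0"
  obtains x where "\<And>i. angle \<alpha> \<theta> x i = y i"
proof
  show "angle \<alpha> \<theta> (\<chi> i. (y i - \<theta>) / \<alpha>) i = y i" for i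
    using assms by (simp add: angle_def)
qed

lemma angle_axis:
  "angle \<alpha> \<theta> (x + t *\<^sub>R axis j 1) i = (if i = j then angle \<alpha> \<theta> x i + \<alpha> * t else angle \<alpha> \<theta> x i)"
  by (simp add: angle_def axis_def algebra_simps)

lemma partial_deriv_eqI:
  assumes "((\<lambda>t. f (x + t *\<^sub>R axis j 1)) has_real_derivative D) (at 0)"
  shows "partial_deriv j f x = D"
  using assms unfolding partial_deriv_def by (rule DERIV_imp_deriv)

section \<open>The convective field\<close>

definition profile_convection :: "real \<Rightarrow> real \<Rightarrow> real \<Rightarrow> real \<Rightarrow> real \<Rightarrow> real" where
  "profile_convection a p q r s =
     profile a p q r s * profile a (p + pi / 2) q r s +
     profile a q r s p * profile a p (q + pi / 2) r s +
     profile a r s p q * profile a p q (r + pi / 2) s +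
     profile a s p q r * profile a p q r (s + pi / 2)"

text \<open>
  Differentiating a linear combination of \<open>sin y\<close> and \<open>cos y\<close> shifts its argument by \<open>\<pi>/2\<close>, and the
  profile is such a combination in each argument.
\<close>
lemma profile_has_derivative:
  "((\<lambda>t. profile a (p + \<alpha> * t) q r s) has_real_derivative \<alpha> * profile a (p + pi / 2) q r s) (at 0)"
  "((\<lambda>t. profile a p (q + \<alpha> * t) r s) has_real_derivative \<alpha> * profile a p (q + pi / 2) r s) (at 0)"
  "((\<lambda>t. profile a p q (r + \<alpha> * t) s) has_real_derivative \<alpha> * profile a p q (r + pi / 2) s) (at 0)"
  "((\<lambda>t. profile a p q r (s + \<alpha> * t)) has_real_derivative \<alpha> * profile a p q r (s + pi / 2)) (at 0)"
  unfolding profile_def sin_cos_add_half_pi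
  by (auto intro!: derivative_eq_intros simp: algebra_simps)

lemma cyclic_index:
  fixes i :: 4
  shows "i + 1 + 1 = i + 2" "i + 1 + 2 = i + 3" "i + 1 + 3 = i"
    "i + 2 + 1 = i + 3" "i + 2 + 2 = i" "i + 2 + 3 = i + 1"
    "i + 3 + 1 = i" "i + 3 + 2 = i + 1" "i + 3 + 3 = i + 2"
  by (simp_all add: add.assoc)

lemma sum_cyclic: "(\<Sum>j\<in>UNIV. f j) = f i + f (i + 1) + f (i + 2) + f (i + 3)"
  for i :: 4 and f :: "4 \<Rightarrow> real"
proof -
  have "\<forall>i::4. (\<Sum>j\<in>UNIV. f j) = f i + f (i + 1) + f (i + 2) + f (i + 3)"
    unfolding forall_4 sum_4 by (simp add: index_4_cyclic)
  then show ?thesis ..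
qed

lemma convective_field_profile_field:
  "convective_field (profile_field \<alpha> \<theta> a c) x $ i =
     \<alpha> * c\<^sup>2 * profile_convection a (angle \<alpha> \<theta> x i) (angle \<alpha> \<theta> x (i + 1))
       (angle \<alpha> \<theta> x (i + 2)) (angle \<alpha> \<theta> x (i + 3))"
proof -
  let ?p = "angle \<alpha> \<theta> x i" and ?q = "angle \<alpha> \<theta> x (i + 1)"
  let ?r = "angle \<alpha> \<theta> x (i + 2)" and ?s = "angle \<alpha> \<theta> x (i + 3)"
  let ?v = "\<lambda>y. profile_field \<alpha> \<theta> a c y $ i"
  have derivs:
    "partial_deriv i ?v x = c * (\<alpha> * profile a (?p + pi / 2) ?q ?r ?s)"
    "partial_deriv (i + 1) ?v x = c * (\<alpha> * profile a ?p (?q + pi / 2) ?r ?s)"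
    "partial_deriv (i + 2) ?v x = c * (\<alpha> * profile a ?p ?q (?r + pi / 2) ?s)"
    "partial_deriv (i + 3) ?v x = c * (\<alpha> * profile a ?p ?q ?r (?s + pi / 2))"
    by (rule partial_deriv_eqI, unfold profile_field_def vec_lambda_beta angle_axis,
        simp, intro DERIV_cmult profile_has_derivative)+
  show ?thesis
    unfolding convective_field_def vec_lambda_beta sum_cyclic[of _ i] derivs
    by (simp only: profile_field_def vec_lambda_beta cyclic_index profile_convection_def)
       (simp add: algebra_simps power2_eq_square)
qed

text \<open>
  For \<open>a = \<pi>/2\<close> the profile is \<open>sin p sin q cos r sin s + cos p cos q sin r cos s\<close>; all terms of the
  convection that depend on \<open>q\<close> or \<open>s\<close> then combine into \<open>sin\<^sup>2 + cos\<^sup>2\<close>. That \<open>q\<close> and \<open>s\<close> drop out is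
  what makes the convective field a gradient.
\<close>
lemma profile_convection_gradient:
  assumes "cos a = 0"
  shows "profile_convection a p q r s = sin p * cos p * cos (2 * r)"
proof -
  have sin_a: "sin a * sin a = 1"
    using sin_cos_squared_add[of a] assms by (simp add: power2_eq_square)
  have reduced: "profile a p q r s = sin p * sin q * cos r * sin s + cos p * cos q * sin r * cos s"
    for p q r s
    by (simp add: profile_def sin_add cos_add assms) (use sin_a in algebra)
  show ?thesis
    unfolding profile_convection_def reduced
    by (simp add: sin_add cos_add cos_double)
       (use sin_cos_squared_add[of p] sin_cos_squared_add[of q] sin_cos_squared_add[of r]
          sin_cos_squared_add[of s] in algebra)
qed

text \<open>
  The next two lemmas give \<open>g\<^sub>1\<close> along the \<open>x\<^sub>2\<close>-direction and \<open>g\<^sub>2\<close> along the \<open>x\<^sub>1\<close>-direction through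
  the point \<open>y = (0, 0, \<pi>/2, 0)\<close>. At this point most factors are \<open>0\<close> or \<open>1\<close>, and the terms that remain
  contribute to the curl with the same sign, so they cannot cancel.
\<close>
lemma profile_convection_second_argument:
  "profile_convection a 0 t (pi / 2) 0 =
     cos a * sin a ^ 3 - (cos a)\<^sup>2 * (sin a)\<^sup>2 * sin t * cos t"
  unfolding profile_convection_def profile_def
  by (simp add: sin_add cos_add) (use sin_cos_squared_add[of t] in algebra)

lemma profile_convection_fourth_argument:
  "profile_convection a 0 (pi / 2) 0 t = (cos a)\<^sup>2 * (sin a)\<^sup>2 * sin t * cos t"
  unfolding profile_convection_def profile_def
  by (simp add: sin_add cos_add) algebra

section \<open>Pressure integrability\<close>

text \<open>
  The component \<open>g\<^sub>i\<close> depends on \<open>y\<^sub>i\<close> and \<open>y\<^sub>i\<^sub>+\<^sub>2\<close> only, so the only mixed derivatives that survive are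
  those for opposite indices \<open>i\<close> and \<open>i + 2\<close>; they are symmetric in the two, as opposition is modulo 4.
\<close>
lemma pressure_integrable_if_cos_eq_0:
  assumes "cos a = 0"
  shows "pressure_integrable (profile_field \<alpha> \<theta> a c)"
proof -
  let ?y = "angle \<alpha> \<theta>"
  have g: "convective_field (profile_field \<alpha> \<theta> a c) x $ i =
      \<alpha> * c\<^sup>2 * (sin (?y x i) * cos (?y x i) * cos (2 * ?y x (i + 2)))" for x i
    by (simp add: convective_field_profile_field profile_convection_gradient[OF assms])
  have deriv: "partial_deriv j (\<lambda>y. convective_field (profile_field \<alpha> \<theta> a c) y $ i) x =
      (if j = i + 2 then - \<alpha>\<^sup>2 * c\<^sup>2 * sin (2 * ?y x i) * sin (2 * ?y x j) else 0)"
    if "i \<noteq> j" for i j x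
  proof (rule partial_deriv_eqI)
    show "((\<lambda>t. convective_field (profile_field \<alpha> \<theta> a c) (x + t *\<^sub>R axis j 1) $ i) has_real_derivative
        (if j = i + 2 then - \<alpha>\<^sup>2 * c\<^sup>2 * sin (2 * ?y x i) * sin (2 * ?y x j) else 0)) (at 0)"
      unfolding g angle_axis using that
      by (auto intro!: derivative_eq_intros simp: sin_double power2_eq_square)
  qed
  have "j = i + 2 \<longleftrightarrow> i = j + 2" for i j :: 4
    by (auto simp: cyclic_index)
  then show ?thesis
    unfolding pressure_integrable_def by (auto simp: deriv)
qed

lemma not_pressure_integrable:
  assumes "\<alpha> \<noteq> 0" "c \<noteq> 0" "sin a \<noteq> 0" "cos a \<noteq> 0"
  shows "\<not> pressure_integrable (profile_field \<alpha> \<theta> a c)"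
proof
  assume integrable: "pressure_integrable (profile_field \<alpha> \<theta> a c)"
  let ?g = "convective_field (profile_field \<alpha> \<theta> a c)"
  let ?K = "\<alpha>\<^sup>2 * c\<^sup>2 * (cos a)\<^sup>2 * (sin a)\<^sup>2"
  obtain x where x: "\<And>i. angle \<alpha> \<theta> x i = (if i = 3 then pi / 2 else 0)"
    using exists_point_with_angles[OF assms(1), of \<theta> "\<lambda>i. if i = 3 then pi / 2 else 0"] by blast
  have g1: "?g (x + t *\<^sub>R axis 2 1) $ 1 =
      \<alpha> * c\<^sup>2 * (cos a * sin a ^ 3 - (cos a)\<^sup>2 * (sin a)\<^sup>2 * sin (\<alpha> * t) * cos (\<alpha> * t))" for t
    by (simp add: convective_field_profile_field angle_axis x
        profile_convection_second_argument)
  have g2: "?g (x + t *\<^sub>R axis 1 1) $ 2 =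
      \<alpha> * c\<^sup>2 * ((cos a)\<^sup>2 * (sin a)\<^sup>2 * sin (\<alpha> * t) * cos (\<alpha> * t))" for t
    by (simp add: convective_field_profile_field angle_axis x
        profile_convection_fourth_argument index_4_cyclic)
  have "partial_deriv 2 (\<lambda>y. ?g y $ 1) x = - ?K"
    by (rule partial_deriv_eqI, unfold g1)
       (auto intro!: derivative_eq_intros simp: power2_eq_square)
  moreover have "partial_deriv 1 (\<lambda>y. ?g y $ 2) x = ?K"
    by (rule partial_deriv_eqI, unfold g2)
       (auto intro!: derivative_eq_intros simp: power2_eq_square)
  moreover have "partial_deriv 2 (\<lambda>y. ?g y $ 1) x = partial_deriv 1 (\<lambda>y. ?g y $ 2) x"
    using integrable unfolding pressure_integrable_def by simp
  ultimately have "?K = 0"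
    by simp
  with assms show False
    by simp
qed

lemma profile_field_eq_0:
  assumes "sin a = 0"
  shows "profile_field \<alpha> \<theta> a c x = 0"
  using assms
  by (simp add: vec_eq_iff profile_field_def profile_def sin_add cos_add algebra_simps)

lemma profile_field_neq_0:
  assumes "\<alpha> \<noteq> 0" "c \<noteq> 0" "cos a = 0"
  shows "\<exists>x. profile_field \<alpha> \<theta> a c x \<noteq> 0"
proof -
  \<comment> \<open>Here the product \<open>sin y\<^sub>1 sin y\<^sub>2 cos y\<^sub>3 sin y\<^sub>4\<close> is \<open>1\<close> and the other product of the profile vanishes.\<close>
  obtain x where x: "\<And>i. angle \<alpha> \<theta> x i = (if i = 3 then 0 else pi / 2)"
    using exists_point_with_angles[OF assms(1), of \<theta> "\<lambda>i. if i = 3 then 0 else pi / 2"] by blast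
  have "profile_field \<alpha> \<theta> a c x $ 1 = c * (sin a)\<^sup>2"
    by (simp add: profile_field_def x profile_def sin_add cos_add power2_eq_square)
  moreover have "sin a \<noteq> 0"
    using assms(3) sin_cos_squared_add[of a] by auto
  ultimately show ?thesis
    using assms(2) by (metis mult_eq_0_iff power_not_zero zero_index)
qed

lemma pressure_integrable_profile_field_iff:
  assumes "\<alpha> \<noteq> 0" "c \<noteq> 0"
  shows "pressure_integrable (profile_field \<alpha> \<theta> a c) \<longleftrightarrow> (sin a)\<^sup>2 * cos a = 0"
proof -
  have "pressure_integrable (profile_field \<alpha> \<theta> a c)" if "sin a = 0"
  proof -
    have "profile_field \<alpha> \<theta> a c = (\<lambda>x. 0)"
      using profile_field_eq_0[OF that] by (rule ext)
    then show ?thesis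
      by (simp add: pressure_integrable_def convective_field_def partial_deriv_def)
  qed
  then show ?thesis
    using pressure_integrable_if_cos_eq_0[of a] not_pressure_integrable[OF assms, of a]
    by (cases "sin a = 0"; cases "cos a = 0") auto
qed

section \<open>The admissible phases\<close>

lemma sin_eq_0_iff_rcong: "sin a = 0 \<longleftrightarrow> [a = 0] (rmod pi)"
  unfolding sin_zero_iff_int2 by (subst rcong_sym_iff) (simp add: rcong_altdef)

lemma cos_eq_0_iff_rcong: "cos a = 0 \<longleftrightarrow> [a = pi / 2] (rmod pi)"
  unfolding cos_zero_iff_int2 by (subst rcong_sym_iff) (simp add: rcong_altdef add.commute)

theorem mainTheorem5:
  fixes \<alpha> v\<^sub>r :: real
  assumes "\<alpha> > 0" and "v\<^sub>r > 0"
  shows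
    "(\<forall>\<theta> a :: real. \<forall>l\<^sub>1 l\<^sub>2 l\<^sub>3 :: int.
        (pressure_integrable (velocity \<alpha> v\<^sub>r (phase \<theta> a l\<^sub>1 l\<^sub>2 l\<^sub>3)) \<longleftrightarrow> (sin a)\<^sup>2 * cos a = 0) \<and>
        ((sin a)\<^sup>2 * cos a = 0 \<longleftrightarrow> [a = 0] (rmod pi) \<or> [a = pi / 2] (rmod pi)) \<and>
        ([a = 0] (rmod pi) \<longrightarrow> (\<forall>x. velocity \<alpha> v\<^sub>r (phase \<theta> a l\<^sub>1 l\<^sub>2 l\<^sub>3) x = 0)) \<and>
        ([a = pi / 2] (rmod pi) \<longrightarrow> \<not> (\<forall>x. velocity \<alpha> v\<^sub>r (phase \<theta> a l\<^sub>1 l\<^sub>2 l\<^sub>3) x = 0))) \<and>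
     {\<xi>. (\<exists>\<theta> a l\<^sub>1 l\<^sub>2 l\<^sub>3. \<xi> = phase \<theta> a l\<^sub>1 l\<^sub>2 l\<^sub>3) \<and>
         \<not> (\<forall>x. velocity \<alpha> v\<^sub>r \<xi> x = 0) \<and>
         pressure_integrable (velocity \<alpha> v\<^sub>r \<xi>)} =
     {vector [\<theta>, \<theta> + pi / 2 + of_int l\<^sub>1 * pi, \<theta> + pi / 2 + of_int l\<^sub>2 * pi, \<theta> + pi / 2 + of_int l\<^sub>3 * pi]
        | (\<theta> :: real) (l\<^sub>1 :: int) (l\<^sub>2 :: int) (l\<^sub>3 :: int). True}"
    (is "?phasewise \<and> ?admissible = ?quarter")
proof
  have integrable_iff:
    "pressure_integrable (velocity \<alpha> v\<^sub>r (phase \<theta> a l\<^sub>1 l\<^sub>2 l\<^sub>3)) \<longleftrightarrow> (sin a)\<^sup>2 * cos a = 0"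
    and vanishes: "sin a = 0 \<Longrightarrow> velocity \<alpha> v\<^sub>r (phase \<theta> a l\<^sub>1 l\<^sub>2 l\<^sub>3) x = 0"
    and nontrivial: "cos a = 0 \<Longrightarrow> \<exists>x. velocity \<alpha> v\<^sub>r (phase \<theta> a l\<^sub>1 l\<^sub>2 l\<^sub>3) x \<noteq> 0"
    for \<theta> a l\<^sub>1 l\<^sub>2 l\<^sub>3 x
  proof -
    obtain c where c: "c\<^sup>2 = v\<^sub>r\<^sup>2"
      and field: "velocity \<alpha> v\<^sub>r (phase \<theta> a l\<^sub>1 l\<^sub>2 l\<^sub>3) = profile_field \<alpha> \<theta> a c"
      by (rule velocity_phase_eq_profile_field)
    have nz: "\<alpha> \<noteq> 0" "c \<noteq> 0"
      using assms c by auto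
    show "pressure_integrable (velocity \<alpha> v\<^sub>r (phase \<theta> a l\<^sub>1 l\<^sub>2 l\<^sub>3)) \<longleftrightarrow> (sin a)\<^sup>2 * cos a = 0"
      unfolding field by (rule pressure_integrable_profile_field_iff[OF nz])
    show "sin a = 0 \<Longrightarrow> velocity \<alpha> v\<^sub>r (phase \<theta> a l\<^sub>1 l\<^sub>2 l\<^sub>3) x = 0"
      unfolding field by (rule profile_field_eq_0)
    show "cos a = 0 \<Longrightarrow> \<exists>x. velocity \<alpha> v\<^sub>r (phase \<theta> a l\<^sub>1 l\<^sub>2 l\<^sub>3) x \<noteq> 0"
      unfolding field by (rule profile_field_neq_0[OF nz])
  qed
  show ?phasewise
    using integrable_iff vanishes nontrivial
    by (auto simp flip: sin_eq_0_iff_rcong cos_eq_0_iff_rcong)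
  \<comment> \<open>The condition on \<open>a\<close> leaves a multiple of \<open>\<pi>\<close> free, which is absorbed into \<open>l\<^sub>1\<close> and \<open>l\<^sub>3\<close>.\<close>
  have quarter_phase: "phase \<theta> (pi / 2 + of_int n * pi) l\<^sub>1 l\<^sub>2 l\<^sub>3 =
      vector [\<theta>, \<theta> + pi / 2 + of_int (n + l\<^sub>1) * pi, \<theta> + pi / 2 + of_int l\<^sub>2 * pi,
        \<theta> + pi / 2 + of_int (n + l\<^sub>3) * pi]" for \<theta> n l\<^sub>1 l\<^sub>2 l\<^sub>3
    by (simp add: phase_def algebra_simps)
  show "?admissible = ?quarter"
  proof (intro set_eqI iffI)
    fix \<xi> assume "\<xi> \<in> ?admissible"
    then obtain \<theta> a l\<^sub>1 l\<^sub>2 l\<^sub>3 x where \<xi>: "\<xi> = phase \<theta> a l\<^sub>1 l\<^sub>2 l\<^sub>3"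
      and x: "velocity \<alpha> v\<^sub>r (phase \<theta> a l\<^sub>1 l\<^sub>2 l\<^sub>3) x \<noteq> 0"
      and "(sin a)\<^sup>2 * cos a = 0"
      using integrable_iff by auto
    then have "cos a = 0"
      using vanishes by auto
    then obtain n :: int where "a = pi / 2 + of_int n * pi"
      unfolding cos_zero_iff_int2 by (auto simp: add.commute)
    then show "\<xi> \<in> ?quarter"
      unfolding \<xi> using quarter_phase by blast
  next
    fix \<xi> assume "\<xi> \<in> ?quarter"
    then obtain \<theta> l\<^sub>1 l\<^sub>2 l\<^sub>3 where \<xi>: "\<xi> = phase \<theta> (pi / 2) l\<^sub>1 l\<^sub>2 l\<^sub>3"
      using quarter_phase[of _ 0] by auto
    then show "\<xi> \<in> ?admissible"
      using integrable_iff[of \<theta> "pi / 2"] nontrivial[of "pi / 2" \<theta>] by fastforce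
  qed
qed

end
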